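(* Let $C=370$, and let $L,\mu,\Delta,\varepsilon>0$ and $\sigma\ge0$ satisfy $L/\mu\ge C$ and $\varepsilon^2\le L\Delta/(96\,C)$. Let $f$, $\mathcal Y$ and the oracle $\mathcal O$ be as defined in the context. For every zero-respecting algorithm interacting with $\mathcal O$, with Bernoulli samples $\xi^0,\xi^1,\dots$ used in the successive calls, $$P_N\le1+\sum_{t=0}^{N-1}\xi^t\qquad\text{for every }N\ge1,$$ where $P_t=\max\bigcup_{s=0}^{t-1}\operatorname{supp}(g_x^s)$ is the largest index of a primal coordinate that has been nonzero in some oracle response among the first $t$ calls ($P_t=0$ if there is none), and $g_x^s$ is the $x$-component of the $s$-th oracle response.
   Context: Scalar functions. $\psi(t)=0$ for $t\le1/2$ and $\psi(t)=\exp(1-(2t-1)^{-2})$ for $t>1/2$; $\varphi(t)=\sqrt e\int_{-\infty}^te^{-s^2/2}\,ds$; $\varphi_0=\varphi(0)=\sqrt{\pi e/2}$; $\bar\varphi(t)=\varphi(t)-\varphi_0$. Parameters. $L_0=L/C$, $\lambda=2\varepsilon/L_0$, $c=\lambda\sqrt{\mu L_0}$, $R=5c/\mu$, $T=\lfloor L_0\Delta/(48\varepsilon^2)\rfloor$ (so $\mu\le L_0$ and $T\ge2$). Objective. $x\in\mathbb R^T$, $y=[y^+;y^-]\in\mathcal Y=[-R,R]^{2(T-1)}$ with $y^\pm=(y_i^\pm)_{i=1}^{T-1}$. For $u\in\mathbb R^T$ let $q(u)=[q^+(u);q^-(u)]$ with $q_i^+(u)=\psi(u_i)-\bar\varphi(u_{i+1})$,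 $q_i^-(u)=\psi(-u_i)+\bar\varphi(-u_{i+1})$, $1\le i\le T-1$, and $$H(u)=-\varphi(u_1)-\sum_{i=1}^{T-1}\Big[\tfrac12\psi(u_i)^2+\tfrac12\psi(-u_i)^2+\varphi_0\big(\psi(u_i)-\psi(-u_i)\big)+\bar\varphi(u_{i+1})^2\Big].$$ Then $f(x,y)=L_0\lambda^2H(x/\lambda)+c\,\langle q(x/\lambda),y\rangle-\frac\mu2\|y\|^2$. Oracle. Let $j(x)=\max\{i:x_i\ne0\}$, $j(0)=0$. With $u=x/\lambda$, let $v(x)\in\mathbb R^{2(T-1)}$ be $c(\psi(u_j)e_{y_j^+}+\psi(-u_j)e_{y_j^-})$ if $1\le j=j(x)\le T-1$, and $v(x)=0$ if $j(x)\in\{0,T\}$, where $e_{y_j^\pm}$ is the dual basis vector of coordinate $y_j^\pm$. Let $$p=\frac{e^2c^2}{e^2c^2+\sigma^2},\qquad \mathcal O(x,y;\xi)=\begin{bmatrix}\nabla_xf(x,y)\\ \nabla_yf(x,y)+(\xi/p-1)v(x)\end{bmatrix},\quad \xi\sim\operatorname{Bernoulli}(p)\in\{0,1\},$$ with a fresh independent $\xi$ at each call. Zero-respecting algorithm: it starts at $(x^0,y^0)=(0,0)$ and has zero-query output $\hat x^0=0$. Every query $(x^t,y^t)$ lies in $\mathbb R^{T}\times\mathcal Y$, and every output $\hat x^t$ (output after $t$ calls) lies in $\mathbb R^{T}$. With $(g_x^s,g_y^s)=\mathcal O(x^s,y^s;\xi^s)$, for every $t\ge1$, $\operatorname{supp}(x^t)\cup\operatorname{supp}(\hat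 x^t)\subseteq\bigcup_{s<t}\operatorname{supp}(g_x^s)$ and $\operatorname{supp}(y^t)\subseteq\bigcup_{s<t}\operatorname{supp}(g_y^s)$, where $\operatorname{supp}(v)=\{i:v_i\ne0\}$. Queries may be adaptive and may use internal randomness independent of the oracle samples. *)

theory Defs
  imports "HOL-Probability.Probability"
begin

definition psi :: "real \<Rightarrow> real" where
  "psi t = (if t \<le> 1/2 then 0 else exp (1 - 1 / (2 * t - 1)\<^sup>2))"

definition phi :: "real \<Rightarrow> real" where
  "phi t = sqrt (exp 1) * set_lebesgue_integral lborel {..t} (\<lambda>s. exp (- s\<^sup>2 / 2))"

definition phi0 :: real where
  "phi0 = phi 0"

definition phibar :: "real \<Rightarrow> real" where
  "phibar t = phi t - phi0"

definition C_abs :: real where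
  "C_abs = 370"

definition par_L0 :: "real \<Rightarrow> real" where
  "par_L0 L = L / C_abs"

definition par_lam :: "real \<Rightarrow> real \<Rightarrow> real" where
  "par_lam L \<epsilon> = 2 * \<epsilon> / par_L0 L"

definition par_c :: "real \<Rightarrow> real \<Rightarrow> real \<Rightarrow> real" where
  "par_c L \<mu> \<epsilon> = par_lam L \<epsilon> * sqrt (\<mu> * par_L0 L)"

definition par_R :: "real \<Rightarrow> real \<Rightarrow> real \<Rightarrow> real" where
  "par_R L \<mu> \<epsilon> = 5 * par_c L \<mu> \<epsilon> / \<mu>"

definition par_T :: "real \<Rightarrow> real \<Rightarrow> real \<Rightarrow> nat" where
  "par_T L \<Delta> \<epsilon> = nat \<lfloor>par_L0 L * \<Delta> / (48 * \<epsilon>\<^sup>2)\<rfloor>"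

definition par_p :: "real \<Rightarrow> real \<Rightarrow> real \<Rightarrow> real \<Rightarrow> real" where
  "par_p L \<mu> \<epsilon> \<sigma> =
     (exp 1)\<^sup>2 * (par_c L \<mu> \<epsilon>)\<^sup>2 / ((exp 1)\<^sup>2 * (par_c L \<mu> \<epsilon>)\<^sup>2 + \<sigma>\<^sup>2)"

text \<open>
  The dimension \<^term>\<open>par_T L \<Delta> \<epsilon>\<close> is computed from real parameters, so vectors are functions on an
  index type that vanish outside the relevant finite index set. Primal indices are \<open>1, \<dots>, T\<close>;
  \<open>Plus i\<close> and \<open>Minus i\<close>, for \<open>1 \<le> i \<le> T - 1\<close>, index the coordinates \<open>i\<close> of the two halves of the
  dual variable.
\<close>

datatype dual_index = Plus nat | Minus nat

type_synonym primal = "nat \<Rightarrow> real"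
type_synonym dual = "dual_index \<Rightarrow> real"

definition dual_indices :: "nat \<Rightarrow> dual_index set" where
  "dual_indices T = Plus ` {1..T - 1} \<union> Minus ` {1..T - 1}"

definition supp :: "('i \<Rightarrow> real) \<Rightarrow> 'i set" where
  "supp v = {i. v i \<noteq> 0}"

definition primal_space :: "nat \<Rightarrow> primal set" where
  "primal_space T = {x. supp x \<subseteq> {1..T}}"

definition dual_box :: "nat \<Rightarrow> real \<Rightarrow> dual set" where
  "dual_box T R = {y. supp y \<subseteq> dual_indices T \<and> (\<forall>k \<in> dual_indices T. y k \<in> {-R..R})}"

text \<open>
  Function types carry no norm, so the gradient is the vector of partial derivatives; the functions
  it is applied to are smooth.
\<close>

definition grad_on :: "'i set \<Rightarrow> (('i \<Rightarrow> real) \<Rightarrow> real) \<Rightarrow> ('i \<Rightarrow> real) \<Rightarrow> 'i \<Rightarrow> real" where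
  "grad_on I F x = (\<lambda>i. if i \<in> I then deriv (\<lambda>s. F (x(i := s))) (x i) else 0)"

fun q_map :: "primal \<Rightarrow> dual" where
  "q_map u (Plus i) = psi (u i) - phibar (u (i + 1))"
| "q_map u (Minus i) = psi (- u i) + phibar (- u (i + 1))"

definition H_fun :: "nat \<Rightarrow> primal \<Rightarrow> real" where
  "H_fun T u = - phi (u 1) - (\<Sum>i = 1..T - 1.
      (psi (u i))\<^sup>2 / 2 + (psi (- u i))\<^sup>2 / 2
      + phi0 * (psi (u i) - psi (- u i)) + (phibar (u (i + 1)))\<^sup>2)"

definition f_obj :: "real \<Rightarrow> real \<Rightarrow> real \<Rightarrow> real \<Rightarrow> primal \<Rightarrow> dual \<Rightarrow> real" where
  "f_obj L \<mu> \<Delta> \<epsilon> x y =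
     (let T = par_T L \<Delta> \<epsilon>; lam = par_lam L \<epsilon>; u = (\<lambda>i. x i / lam) in
        par_L0 L * lam\<^sup>2 * H_fun T u
        + par_c L \<mu> \<epsilon> * (\<Sum>k \<in> dual_indices T. q_map u k * y k)
        - \<mu> / 2 * (\<Sum>k \<in> dual_indices T. (y k)\<^sup>2))"

definition last_index :: "primal \<Rightarrow> nat" where
  "last_index x = Max (insert 0 (supp x))"

definition v_vec :: "real \<Rightarrow> real \<Rightarrow> real \<Rightarrow> real \<Rightarrow> primal \<Rightarrow> dual" where
  "v_vec L \<mu> \<Delta> \<epsilon> x =
     (let j = last_index x; u = (\<lambda>i. x i / par_lam L \<epsilon>) in
      if 1 \<le> j \<and> j \<le> par_T L \<Delta> \<epsilon> - 1
      then (\<lambda>k. par_c L \<mu> \<epsilon> *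
              (psi (u j) * of_bool (k = Plus j) + psi (- u j) * of_bool (k = Minus j)))
      else (\<lambda>k. 0))"

text \<open>A Bernoulli sample is a boolean, read as \<open>1\<close> for \<open>True\<close> and \<open>0\<close> for \<open>False\<close>.\<close>

definition grad_response ::
    "real \<Rightarrow> real \<Rightarrow> real \<Rightarrow> real \<Rightarrow> real \<Rightarrow> primal \<times> dual \<Rightarrow> bool \<Rightarrow> primal \<times> dual" where
  "grad_response L \<mu> \<Delta> \<epsilon> \<sigma> = (\<lambda>(x, y) \<xi>.
     (let T = par_T L \<Delta> \<epsilon> in
       (grad_on {1..T} (\<lambda>x'. f_obj L \<mu> \<Delta> \<epsilon> x' y) x,
        \<lambda>k. grad_on (dual_indices T) (\<lambda>y'. f_obj L \<mu> \<Delta> \<epsilon> x y') y k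
             + (of_bool \<xi> / par_p L \<mu> \<epsilon> \<sigma> - 1) * v_vec L \<mu> \<Delta> \<epsilon> x k)))"

text \<open>
  An algorithm maps its internal randomness (a seed of type \<open>'r\<close>) and the list of all responses
  received so far to its next query and its current output. In a run, seed and samples are fixed.
\<close>

record 'r algorithm =
  query :: "'r \<Rightarrow> (primal \<times> dual) list \<Rightarrow> primal \<times> dual"
  recommend :: "'r \<Rightarrow> (primal \<times> dual) list \<Rightarrow> primal"

type_synonym responder = "primal \<times> dual \<Rightarrow> bool \<Rightarrow> primal \<times> dual"

primrec responses ::
    "responder \<Rightarrow> 'r algorithm \<Rightarrow> 'r \<Rightarrow> (nat \<Rightarrow> bool) \<Rightarrow> nat \<Rightarrow> (primal \<times> dual) list" where
  "responses Or A r \<xi> 0 = []"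
| "responses Or A r \<xi> (Suc t) =
     responses Or A r \<xi> t @ [Or (query A r (responses Or A r \<xi> t)) (\<xi> t)]"

definition query_at ::
    "responder \<Rightarrow> 'r algorithm \<Rightarrow> 'r \<Rightarrow> (nat \<Rightarrow> bool) \<Rightarrow> nat \<Rightarrow> primal \<times> dual" where
  "query_at Or A r \<xi> t = query A r (responses Or A r \<xi> t)"

definition output_at ::
    "responder \<Rightarrow> 'r algorithm \<Rightarrow> 'r \<Rightarrow> (nat \<Rightarrow> bool) \<Rightarrow> nat \<Rightarrow> primal" where
  "output_at Or A r \<xi> t = recommend A r (responses Or A r \<xi> t)"

definition response_at ::
    "responder \<Rightarrow> 'r algorithm \<Rightarrow> 'r \<Rightarrow> (nat \<Rightarrow> bool) \<Rightarrow> nat \<Rightarrow> primal \<times> dual" where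
  "response_at Or A r \<xi> t = Or (query_at Or A r \<xi> t) (\<xi> t)"

definition zero_respecting_run ::
    "nat \<Rightarrow> real \<Rightarrow> responder \<Rightarrow> 'r algorithm \<Rightarrow> 'r \<Rightarrow> (nat \<Rightarrow> bool) \<Rightarrow> bool" where
  "zero_respecting_run T R Or A r \<xi> \<longleftrightarrow>
     query_at Or A r \<xi> 0 = (\<lambda>i. 0, \<lambda>k. 0) \<and>
     output_at Or A r \<xi> 0 = (\<lambda>i. 0) \<and>
     (\<forall>t. query_at Or A r \<xi> t \<in> primal_space T \<times> dual_box T R) \<and>
     (\<forall>t. output_at Or A r \<xi> t \<in> primal_space T) \<and>
     (\<forall>t \<ge> 1.
        supp (fst (query_at Or A r \<xi> t)) \<union> supp (output_at Or A r \<xi> t)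
          \<subseteq> (\<Union>s<t. supp (fst (response_at Or A r \<xi> s))) \<and>
        supp (snd (query_at Or A r \<xi> t))
          \<subseteq> (\<Union>s<t. supp (snd (response_at Or A r \<xi> s))))"

definition sample_model ::
    "'w measure \<Rightarrow> 'r measure \<Rightarrow> real \<Rightarrow> ('w \<Rightarrow> 'r) \<Rightarrow> (nat \<Rightarrow> 'w \<Rightarrow> bool) \<Rightarrow> bool" where
  "sample_model M S p seed \<xi> \<longleftrightarrow>
     prob_space M \<and>
     seed \<in> measurable M S \<and>
     prob_space.indep_vars M (\<lambda>_. count_space UNIV) \<xi> UNIV \<and>
     (\<forall>t. distr M (count_space UNIV) (\<xi> t) = measure_pmf (bernoulli_pmf p)) \<and>
     prob_space.indep_set M
       {seed -` B \<inter> space M | B. B \<in> sets S}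
       {(\<lambda>\<omega> t. \<xi> t \<omega>) -` B \<inter> space M | B. B \<in> sets (Pi\<^sub>M UNIV (\<lambda>_. count_space UNIV))}"

definition zero_respecting_algorithm ::
    "'w measure \<Rightarrow> nat \<Rightarrow> real \<Rightarrow> responder \<Rightarrow> 'r algorithm
       \<Rightarrow> ('w \<Rightarrow> 'r) \<Rightarrow> (nat \<Rightarrow> 'w \<Rightarrow> bool) \<Rightarrow> bool" where
  "zero_respecting_algorithm M T R Or A seed \<xi> \<longleftrightarrow>
     (\<forall>\<omega> \<in> space M. zero_respecting_run T R Or A (seed \<omega>) (\<lambda>t. \<xi> t \<omega>))"

definition progress ::
    "responder \<Rightarrow> 'r algorithm \<Rightarrow> 'r \<Rightarrow> (nat \<Rightarrow> bool) \<Rightarrow> nat \<Rightarrow> nat" where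
  "progress Or A r \<xi> t = Max (insert 0 (\<Union>s<t. supp (fst (response_at Or A r \<xi> s))))"

end

theory Submission
  imports Defs
begin

text \<open>
  Suppose \<open>m\<close> of the samples so far were \<open>1\<close>. By induction on the calls, only primal coordinates up to
  \<open>m + 1\<close> and dual coordinates up to \<open>m\<close> have been nonzero in a response. Since \<open>\<psi>\<close> vanishes near
  \<open>0\<close> and \<open>\<phi> - \<phi>(0)\<close> enters \<open>H\<close> squared, a primal coordinate \<open>i \<ge> 2\<close> with \<open>x\<^sub>i = 0\<close> has
  a nonzero partial derivative only if a dual coordinate with index \<open>i - 1\<close> is nonzero. In the dual
  block, the coordinates beyond \<open>j(x)\<close> are not excited by \<open>x\<close>, and when \<open>\<xi> = 0\<close> the correction
  \<open>- v(x)\<close> exactly cancels the excitation of the coordinates with index \<open>j(x)\<close>. So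
  a new dual index costs one sample equal to \<open>1\<close>.
\<close>

section \<open>Behaviour of the scalar functions near zero\<close>

lemma integrable_gaussian: "integrable lborel (\<lambda>s::real. exp (- s\<^sup>2 / 2))"
proof -
  have "integrable lborel (\<lambda>s::real. sqrt (2 * pi) * std_normal_density s)"
    by (intro integrable_mult_right integrable_normal_density) simp
  then show ?thesis
    by (simp add: std_normal_density_def)
qed

text \<open>The integrand lies between 0 and 1, so its integral over \<open>{s<..t}\<close> is at
  most \<open>t - s\<close>. This Lipschitz bound takes the place of a formula for the derivative of
  \<open>phi\<close>.\<close>

lemma phi_diff_le:
  assumes "s \<le> t"
  shows "\<bar>phi t - phi s\<bar> \<le> sqrt (exp 1) * (t - s)"
proof -
  let ?g = "\<lambda>s::real. exp (- s\<^sup>2 / 2)"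
  have int: "set_integrable lborel B ?g" if "B \<in> sets lborel" for B
    using integrable_gaussian that unfolding set_integrable_def
    by (rule integrable_mult_indicator[rotated])
  have "set_lebesgue_integral lborel ({..s} \<union> {s<..t}) ?g
      = set_lebesgue_integral lborel {..s} ?g + set_lebesgue_integral lborel {s<..t} ?g"
    by (intro set_integral_Un int) auto
  moreover have "{..s} \<union> {s<..t} = {..t}"
    using assms by auto
  ultimately have eq: "phi t - phi s = sqrt (exp 1) * set_lebesgue_integral lborel {s<..t} ?g"
    by (simp add: phi_def algebra_simps)
  have "set_lebesgue_integral lborel {s<..t} ?g \<le> set_lebesgue_integral lborel {s<..t} (\<lambda>_. 1)"
    by (intro set_integral_mono int) (use assms in \<open>auto simp: set_integrable_def integrable_indicator_iff\<close>)
  also have "\<dots> = t - s"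
    using assms by (simp add: set_lebesgue_integral_def)
  finally have "set_lebesgue_integral lborel {s<..t} ?g \<le> t - s" .
  moreover have "0 \<le> set_lebesgue_integral lborel {s<..t} ?g"
    unfolding set_lebesgue_integral_def by (intro integral_nonneg_AE) auto
  ultimately show ?thesis
    unfolding eq by (simp add: abs_mult)
qed

lemma abs_phibar_le: "\<bar>phibar t\<bar> \<le> sqrt (exp 1) * \<bar>t\<bar>"
  using phi_diff_le[of 0 t] phi_diff_le[of t 0]
  by (cases "t \<ge> 0") (auto simp: phibar_def phi0_def abs_minus_commute)

text \<open>The difference quotient of the square at 0 is bounded by
  \<open>K\<^sup>2 * \<bar>h\<bar>\<close>, whether or not \<open>g\<close> itself is differentiable
  there.\<close>

lemma DERIV_power2_of_linear_bound:
  fixes g :: "real \<Rightarrow> real"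
  assumes "\<And>s. \<bar>g s\<bar> \<le> K * \<bar>s\<bar>"
  shows "((\<lambda>s. (g s)\<^sup>2) has_real_derivative 0) (at 0)"
proof -
  have g0: "g 0 = 0"
    using assms[of 0] by simp
  have "((\<lambda>h. (g h)\<^sup>2 / h) \<longlongrightarrow> 0) (at 0)"
  proof (rule Lim_null_comparison)
    have "norm ((g h)\<^sup>2 / h) \<le> K\<^sup>2 * \<bar>h\<bar>" for h
    proof (cases "h = 0")
      case False
      have "\<bar>g h\<bar>\<^sup>2 \<le> (K * \<bar>h\<bar>)\<^sup>2"
        by (intro power_mono assms) simp
      then show ?thesis
        using False by (simp add: divide_simps power_mult_distrib power2_eq_square mult_ac)
    qed simp
    then show "\<forall>\<^sub>F h in at 0. norm ((g h)\<^sup>2 / h) \<le> K\<^sup>2 * \<bar>h\<bar>"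
      by simp
    show "((\<lambda>h. K\<^sup>2 * \<bar>h\<bar>) \<longlongrightarrow> 0) (at 0)"
      by (auto intro!: tendsto_eq_intros)
  qed
  then show ?thesis
    by (simp add: DERIV_def g0)
qed

lemma DERIV_phibar_sq: "((\<lambda>s. (phibar (s / l))\<^sup>2) has_real_derivative 0) (at 0)"
  \<comment> \<open>For \<open>l = 0\<close> both \<open>s / l\<close> and \<open>K\<close> are 0 by
    the convention on division, and the bound still holds.\<close>
  by (rule DERIV_power2_of_linear_bound[where K = "sqrt (exp 1) / \<bar>l\<bar>"])
     (use abs_phibar_le[of "_ / l"] in \<open>simp add: abs_divide\<close>)

text \<open>\<open>psi\<close> is 0 up to \<open>1/2\<close>, so by continuity of \<open>g\<close>
  the composition vanishes on a whole neighbourhood of \<open>a\<close>.\<close>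

lemma DERIV_psi_zero:
  fixes g :: "real \<Rightarrow> real"
  assumes "isCont g a" "g a = 0"
  shows "((\<lambda>s. psi (g s)) has_real_derivative 0) (at a)"
proof -
  have "(g \<longlongrightarrow> g a) (nhds a)"
    using assms(1) by (simp add: isCont_def tendsto_at_iff_tendsto_nhds)
  then have "\<forall>\<^sub>F s in nhds a. g s < 1 / 2"
    by (rule order_tendstoD) (simp add: assms(2))
  then have "\<forall>\<^sub>F s in nhds a. psi (g s) = 0"
    by eventually_elim (simp add: psi_def)
  then show ?thesis
    by (subst DERIV_cong_ev[OF refl _ refl]) auto
qed

section \<open>Partial derivatives of the objective\<close>

text \<open>Two kinds of term could have a nonzero slope: \<open>phi (u 1)\<close>, which
  \<open>i \<ge> 2\<close> excludes, and the unsquared \<open>phibar\<close> of \<open>u i\<close>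
  or \<open>- u i\<close> in \<open>q_map\<close>, whose factor is a dual coordinate of index
  \<open>i - 1\<close>.\<close>

lemma DERIV_f_obj_primal_zero:
  assumes i: "i \<ge> 2" and xi: "x i = 0"
    and y: "y (Plus (i - 1)) = 0" "y (Minus (i - 1)) = 0"
  shows "((\<lambda>s. f_obj L \<mu> \<Delta> \<epsilon> (x(i := s)) y) has_real_derivative 0) (at 0)"
proof -
  define T l where "T = par_T L \<Delta> \<epsilon>" and "l = par_lam L \<epsilon>"
  define u where "u s = (\<lambda>k. (x(i := s)) k / l)" for s
  have cont: "isCont (\<lambda>s. s / l) 0"
    by (cases "l = 0") (auto intro!: continuous_intros)
  have psi_p: "((\<lambda>s. psi (u s k)) has_real_derivative 0) (at 0)" for k
  proof (cases "k = i")
    case True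
    then show ?thesis
      using DERIV_psi_zero[OF cont] by (simp add: u_def)
  qed (simp add: u_def)
  have psi_m: "((\<lambda>s. psi (- u s k)) has_real_derivative 0) (at 0)" for k
  proof (cases "k = i")
    case True
    then show ?thesis
      using DERIV_psi_zero[OF isCont_minus[OF cont]] by (simp add: u_def)
  qed (simp add: u_def)
  have bar: "((\<lambda>s. (phibar (u s k))\<^sup>2) has_real_derivative 0) (at 0)" for k
    using DERIV_phibar_sq[of l] by (cases "k = i") (simp_all add: u_def)
  have "((\<lambda>s. phi (u s 1)) has_real_derivative 0) (at 0)"
    using i by (simp add: u_def)
  moreover have "((\<lambda>s. \<Sum>k = 1..T - 1. (psi (u s k))\<^sup>2 / 2 + (psi (- u s k))\<^sup>2 / 2
      + phi0 * (psi (u s k) - psi (- u s k)) + (phibar (u s (k + 1)))\<^sup>2) has_real_derivative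
        (\<Sum>k = 1..T - 1. 0 + 0)) (at 0)"
    by (intro DERIV_sum DERIV_add[OF _ bar]) (auto intro!: derivative_eq_intros psi_p psi_m)
  ultimately have H: "((\<lambda>s. H_fun T (u s)) has_real_derivative 0) (at 0)"
    unfolding H_fun_def by (rule DERIV_cong[OF DERIV_diff[OF DERIV_minus]]) simp
  have q: "((\<lambda>s. q_map (u s) k * y k) has_real_derivative 0) (at 0)" for k
  \<comment> \<open>If \<open>y k \<noteq> 0\<close>, the index of \<open>k\<close> is not
    \<open>i - 1\<close>, so its \<open>phibar\<close> part does not involve coordinate
    \<open>i\<close>.\<close>
  proof (cases "y k = 0")
    case False
    show ?thesis
    proof (cases k)
      case (Plus m)
      then have "m + 1 \<noteq> i"
        using False y by auto
      then have "((\<lambda>s. phibar (u s (m + 1))) has_real_derivative 0) (at 0)"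
        by (simp add: u_def)
      then show ?thesis
        unfolding Plus q_map.simps by (auto intro!: derivative_eq_intros psi_p)
    next
      case (Minus m)
      then have "m + 1 \<noteq> i"
        using False y by auto
      then have "((\<lambda>s. phibar (- u s (m + 1))) has_real_derivative 0) (at 0)"
        by (simp add: u_def)
      then show ?thesis
        unfolding Minus q_map.simps by (auto intro!: derivative_eq_intros psi_m)
    qed
  qed simp
  show ?thesis
    unfolding f_obj_def Let_def T_def[symmetric] l_def[symmetric] u_def[symmetric]
    by (rule DERIV_cong[OF DERIV_diff[OF DERIV_add[OF DERIV_cmult[OF H] DERIV_cmult[OF DERIV_sum[OF q]]] DERIV_const]]) simp
qed

text \<open>To be applied where \<open>y k = 0\<close>: there only the excitation by the primal
  point remains.\<close>

lemma DERIV_f_obj_dual: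
  assumes k: "k \<in> dual_indices (par_T L \<Delta> \<epsilon>)"
  shows "((\<lambda>s. f_obj L \<mu> \<Delta> \<epsilon> x (y(k := s))) has_real_derivative
      par_c L \<mu> \<epsilon> * q_map (\<lambda>i. x i / par_lam L \<epsilon>) k - \<mu> * y k) (at (y k))"
proof -
  let ?I = "dual_indices (par_T L \<Delta> \<epsilon>)"
  have fin: "finite ?I"
    by (simp add: dual_indices_def)
  have lin: "((\<lambda>s. \<Sum>j\<in>?I. a j * (y(k := s)) j) has_real_derivative a k) (at (y k))" for a
  proof -
    have "((\<lambda>s. a j * (y(k := s)) j) has_real_derivative (if j = k then a j else 0)) (at (y k))" for j
      by (cases "j = k") (auto intro!: derivative_eq_intros)
    then have "((\<lambda>s. \<Sum>j\<in>?I. a j * (y(k := s)) j) has_real_derivative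
        (\<Sum>j\<in>?I. if j = k then a j else 0)) (at (y k))"
      by (intro DERIV_sum)
    then show ?thesis
      using fin k by simp
  qed
  have sq: "((\<lambda>s. \<Sum>j\<in>?I. ((y(k := s)) j)\<^sup>2) has_real_derivative 2 * y k) (at (y k))"
  proof -
    have "((\<lambda>s. ((y(k := s)) j)\<^sup>2) has_real_derivative (if j = k then 2 * y j else 0)) (at (y k))" for j
      by (cases "j = k") (auto intro!: derivative_eq_intros)
    then have "((\<lambda>s. \<Sum>j\<in>?I. ((y(k := s)) j)\<^sup>2) has_real_derivative
        (\<Sum>j\<in>?I. if j = k then 2 * y j else 0)) (at (y k))"
      by (intro DERIV_sum)
    then show ?thesis
      using fin k by simp
  qed
  show ?thesis
    unfolding f_obj_def Let_def
    by (rule DERIV_cong[OF DERIV_diff[OF DERIV_add[OF DERIV_const DERIV_cmult[OF lin]] DERIV_cmult[OF sq]]]) simp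
qed

section \<open>Supports of a single response\<close>

text \<open>The two halves of the dual variable advance together, so progress is measured by the
  index alone.\<close>

fun dual_position :: "dual_index \<Rightarrow> nat" where
  "dual_position (Plus i) = i"
| "dual_position (Minus i) = i"

text \<open>For \<open>i > m + 1\<close> both \<open>x i\<close> and the dual coordinates of index
  \<open>i - 1 > m\<close> vanish, so the partial derivative is 0. The range up to \<open>T\<close>
  is recorded to keep supports finite.\<close>

lemma primal_response_supp:
  assumes x: "supp x \<subseteq> {..m + 1}" and y: "\<forall>k \<in> supp y. dual_position k \<le> m"
  shows "supp (fst (grad_response L \<mu> \<Delta> \<epsilon> \<sigma> (x, y) b)) \<subseteq> {1..par_T L \<Delta> \<epsilon>} \<inter> {..m + 1}"
proof
  fix i
  assume "i \<in> supp (fst (grad_response L \<mu> \<Delta> \<epsilon> \<sigma> (x, y) b))"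
  then have i: "i \<in> {1..par_T L \<Delta> \<epsilon>}"
    and nz: "deriv (\<lambda>s. f_obj L \<mu> \<Delta> \<epsilon> (x(i := s)) y) (x i) \<noteq> 0"
    by (auto simp: supp_def grad_response_def Let_def grad_on_def split: if_splits)
  have "i \<le> m + 1"
  proof (rule ccontr)
    assume big: "\<not> i \<le> m + 1"
    then have xi: "x i = 0"
      using x by (auto simp: supp_def)
    have "y (Plus (i - 1)) = 0" "y (Minus (i - 1)) = 0"
      using y big by (force simp: supp_def)+
    with DERIV_f_obj_primal_zero[of i x y] big xi nz show False
      by (auto dest!: DERIV_imp_deriv)
  qed
  with i show "i \<in> {1..par_T L \<Delta> \<epsilon>} \<inter> {..m + 1}"
    by simp
qed

lemma phibar_0 [simp]: "phibar 0 = 0"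
  by (simp add: phibar_def phi0_def)

lemma psi_0 [simp]: "psi 0 = 0"
  by (simp add: psi_def)

text \<open>Beyond \<open>m\<close> the coordinate \<open>y k\<close> is 0, so the gradient entry is
  \<open>c\<close> times \<open>q_map u k\<close>, which depends only on \<open>u\<close> at the
  position of \<open>k\<close> and the next one. The position is compared with \<open>j\<close>,
  which is at most \<open>m + 1\<close>.\<close>

lemma dual_response_supp:
  assumes x: "supp x \<subseteq> {..m + 1}"
    and y: "\<forall>k \<in> supp y. dual_position k \<le> m"
    and k: "k \<in> supp (snd (grad_response L \<mu> \<Delta> \<epsilon> \<sigma> (x, y) b))"
  shows "dual_position k \<le> m + of_bool b"
proof (rule ccontr)
  assume big: "\<not> dual_position k \<le> m + of_bool b"
  define T l where "T = par_T L \<Delta> \<epsilon>" and "l = par_lam L \<epsilon>"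
  define u where "u i = x i / l" for i
  define j where "j = last_index x"
  have fin: "finite (supp x)"
    using x finite_subset by blast
  have j_le: "j \<le> m + 1"
    using x fin by (auto simp: j_def last_index_def)
  have u0: "u i = 0" if "i > j" for i
  proof -
    have "i \<notin> supp x"
      using that fin by (auto simp: j_def last_index_def)
    then show ?thesis
      by (simp add: supp_def u_def)
  qed
  have yk: "y k = 0"
    using y big by (auto simp: supp_def)
  have v: "v_vec L \<mu> \<Delta> \<epsilon> x k =
      (if 1 \<le> j \<and> j \<le> T - 1
       then par_c L \<mu> \<epsilon> * (psi (u j) * of_bool (k = Plus j) + psi (- u j) * of_bool (k = Minus j))
       else 0)"
    by (simp add: v_vec_def Let_def j_def T_def u_def l_def)
  have v0: "v_vec L \<mu> \<Delta> \<epsilon> x k = 0" if "k \<notin> dual_indices T"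
    using that unfolding v by (auto simp: dual_indices_def)
  have resp: "grad_on (dual_indices T) (\<lambda>y'. f_obj L \<mu> \<Delta> \<epsilon> x y') y k
        + (of_bool b / par_p L \<mu> \<epsilon> \<sigma> - 1) * v_vec L \<mu> \<Delta> \<epsilon> x k \<noteq> 0"
    using k by (simp add: supp_def grad_response_def Let_def T_def)
  then have kI: "k \<in> dual_indices T"
    using v0 by (cases "k \<in> dual_indices T") (auto simp: grad_on_def)
  have grad: "grad_on (dual_indices T) (\<lambda>y'. f_obj L \<mu> \<Delta> \<epsilon> x y') y k = par_c L \<mu> \<epsilon> * q_map u k"
    using DERIV_imp_deriv[OF DERIV_f_obj_dual[OF kI[unfolded T_def], of \<mu> x y]] kI yk
    by (simp add: grad_on_def u_def[abs_def] l_def)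
  have range: "1 \<le> dual_position k" "dual_position k \<le> T - 1"
    using kI by (auto simp: dual_indices_def)
  show False
  proof (cases "dual_position k = j")
    case True
    \<comment> \<open>A sample equal to 1 would make the position exceed \<open>m + 1\<close>, but
      \<open>j \<le> m + 1\<close>.\<close>
    with big j_le have "\<not> b"
      by auto
    \<comment> \<open>As \<open>u (j + 1) = 0\<close>, the gradient entry equals that of
      \<open>v_vec\<close>, and the noise factor is \<open>-1\<close>.\<close>
    with resp True range show False
      unfolding grad v by (cases k) (auto simp: u0 split: if_splits)
  next
    case False
    with big j_le have "dual_position k > j"
      by auto
    with resp show False
      \<comment> \<open>Both entries of \<open>u\<close> that enter \<open>q_map u k\<close> lie
        beyond \<open>j\<close>, and \<open>v_vec\<close> is 0 at \<open>k\<close>.\<close>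
      unfolding grad v by (cases k) (auto simp: u0 split: if_splits)
  qed
qed

section \<open>Induction along a run\<close>

text \<open>The primal block carries no noise, so its bound counts the samples before call
  \<open>t\<close>; the dual bound also counts the sample of call \<open>t\<close>. The induction is
  strong because a query draws on all earlier responses.\<close>

lemma zero_respecting_run_supports:
  fixes \<xi> :: "nat \<Rightarrow> bool"
  defines "\<And>n. m n \<equiv> (\<Sum>s<n. of_bool (\<xi> s) :: nat)"
  assumes run: "zero_respecting_run (par_T L \<Delta> \<epsilon>) R (grad_response L \<mu> \<Delta> \<epsilon> \<sigma>) A r \<xi>"
  shows "supp (fst (response_at (grad_response L \<mu> \<Delta> \<epsilon> \<sigma>) A r \<xi> t))
           \<subseteq> {1..par_T L \<Delta> \<epsilon>} \<inter> {..m t + 1}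
       \<and> (\<forall>k \<in> supp (snd (response_at (grad_response L \<mu> \<Delta> \<epsilon> \<sigma>) A r \<xi> t)).
             dual_position k \<le> m (Suc t))"
proof (induction t rule: less_induct)
  case (less t)
  let ?Or = "grad_response L \<mu> \<Delta> \<epsilon> \<sigma>"
  have mono: "m a \<le> m b" if "a \<le> b" for a b
    unfolding m_def using that by (intro sum_mono2) auto
  obtain x y where xy: "query_at ?Or A r \<xi> t = (x, y)"
    by fastforce
  have "supp x \<subseteq> {..m t + 1} \<and> (\<forall>k \<in> supp y. dual_position k \<le> m t)"
  proof (cases "t = 0")
    case True
    then have "x = (\<lambda>i. 0)" "y = (\<lambda>k. 0)"
      using run xy by (auto simp: zero_respecting_run_def)
    then show ?thesis
      by (simp add: supp_def)
  next
    case False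
    then have sub: "supp x \<subseteq> (\<Union>s<t. supp (fst (response_at ?Or A r \<xi> s)))"
      "supp y \<subseteq> (\<Union>s<t. supp (snd (response_at ?Or A r \<xi> s)))"
      using run xy by (auto simp: zero_respecting_run_def Suc_le_eq dest!: spec[of _ t])
    have "i \<le> m t + 1" if i: "i \<in> supp x" for i
    proof -
      obtain s where s: "s < t" "i \<in> supp (fst (response_at ?Or A r \<xi> s))"
        using sub(1) i by auto
      then have "i \<le> m s + 1"
        using less by blast
      with mono[of s t] s(1) show ?thesis
        by simp
    qed
    moreover have "dual_position k \<le> m t" if k: "k \<in> supp y" for k
    proof -
      obtain s where s: "s < t" "k \<in> supp (snd (response_at ?Or A r \<xi> s))"
        using sub(2) k by auto
      then have "dual_position k \<le> m (Suc s)"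
        using less by blast
      \<comment> \<open>The sample of call \<open>s\<close> is already counted in
        \<open>m t\<close>, since \<open>Suc s \<le> t\<close>.\<close>
      with mono[of "Suc s" t] s(1) show ?thesis
        by simp
    qed
    ultimately show ?thesis
      by auto
  qed
  then have "supp x \<subseteq> {..m t + 1}" "\<forall>k \<in> supp y. dual_position k \<le> m t"
    by auto
  moreover have "m (Suc t) = m t + of_bool (\<xi> t)"
    by (simp add: m_def)
  ultimately show ?case
    using primal_response_supp dual_response_supp
    by (metis response_at_def xy)
qed

theorem lemma5:
  fixes L \<mu> \<Delta> \<epsilon> \<sigma> :: real
    and M :: "'w measure" and S :: "'r measure"
    and seed :: "'w \<Rightarrow> 'r" and \<xi> :: "nat \<Rightarrow> 'w \<Rightarrow> bool"
    and A :: "'r algorithm"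
  assumes "L > 0" and "\<mu> > 0" and "\<Delta> > 0" and "\<epsilon> > 0" and "\<sigma> \<ge> 0"
    and "L / \<mu> \<ge> C_abs"
    and "\<epsilon>\<^sup>2 \<le> L * \<Delta> / (96 * C_abs)"
    and "sample_model M S (par_p L \<mu> \<epsilon> \<sigma>) seed \<xi>"
    and "zero_respecting_algorithm M (par_T L \<Delta> \<epsilon>) (par_R L \<mu> \<epsilon>)
           (grad_response L \<mu> \<Delta> \<epsilon> \<sigma>) A seed \<xi>"
  shows "\<forall>\<omega> \<in> space M. \<forall>N \<ge> 1.
           progress (grad_response L \<mu> \<Delta> \<epsilon> \<sigma>) A (seed \<omega>) (\<lambda>t. \<xi> t \<omega>) N
             \<le> 1 + (\<Sum>t<N. of_bool (\<xi> t \<omega>))"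
proof (intro ballI allI impI)
  fix \<omega> and N :: nat
  assume "\<omega> \<in> space M"
  then have run: "zero_respecting_run (par_T L \<Delta> \<epsilon>) (par_R L \<mu> \<epsilon>)
      (grad_response L \<mu> \<Delta> \<epsilon> \<sigma>) A (seed \<omega>) (\<lambda>t. \<xi> t \<omega>)"
    using assms(9) by (simp add: zero_respecting_algorithm_def)
  let ?P = "\<Union>s<N. supp (fst (response_at (grad_response L \<mu> \<Delta> \<epsilon> \<sigma>) A (seed \<omega>) (\<lambda>t. \<xi> t \<omega>) s))"
  note supports = zero_respecting_run_supports[OF run]
  have "?P \<subseteq> {1..par_T L \<Delta> \<epsilon>}"
    using supports by blast
  \<comment> \<open>Finiteness lets \<open>Max\<close> be bounded element by element.\<close>
  then have "finite ?P"
    using finite_subset by blast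
  moreover have "i \<le> 1 + (\<Sum>t<N. of_bool (\<xi> t \<omega>))" if i: "i \<in> ?P" for i
  proof -
    obtain s where s: "s < N" "i \<le> (\<Sum>t<s. of_bool (\<xi> t \<omega>)) + 1"
      using i supports by blast
    moreover have "(\<Sum>t<s. of_bool (\<xi> t \<omega>)) \<le> (\<Sum>t<N. of_bool (\<xi> t \<omega>) :: nat)"
      using s(1) by (intro sum_mono2) auto
    ultimately show ?thesis
      by simp
  qed
  ultimately show "progress (grad_response L \<mu> \<Delta> \<epsilon> \<sigma>) A (seed \<omega>) (\<lambda>t. \<xi> t \<omega>) N
      \<le> 1 + (\<Sum>t<N. of_bool (\<xi> t \<omega>))"
    by (simp add: progress_def)
qed

end
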